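(* Consider the noiseless ternary remotely powered channel with $\mathcal X=\mathcal Y=\{0,1,2\}$, $Y_t=X_t$, $\phi(x)=x$, battery capacity $\bar B=2$ and energy alphabet $\mathcal E=\{0,2\}$. Its capacity with a fully cognitive charger, for $0<\Gamma\le10/9$, is $$C_M(\Gamma)=\log(\zeta^2+2\zeta-3)+\frac{\Gamma-2}{2}\log(\zeta^2-5)-\Gamma,$$ where $\zeta$ is the unique real root of the cubic equation $$\Gamma\zeta^3+2(\Gamma-1)\zeta^2-(3\Gamma+4)\zeta-10=0.$$ Additionally, $C_M(0)=0$ and $C_M(\Gamma)=\log3$ for $\Gamma>10/9$.
   Context: Logarithms are to base 2. The battery level satisfies $B_1=\bar B=2$ and $B_{t+1}=\min\{B_t+E_t,\bar B\}-X_t$; the input must satisfy $X_t\le\min\{B_t+E_t,\bar B\}$, where $E_t\in\mathcal E$ is the energy sent by the charger at time $t$. Cost constraint: $\frac1n\sum_{t=1}^nE_t\le\Gamma$. An $(R,n)$ code with fully cognitive charger consists of a message set $\mathcal M=\{1,\dots,2^{nR}\}$ (rounded to an integer), transmitter functions $f_t^{\mathrm{Tx}}:\mathcal M\times\mathcal E^t\to\mathcal X$ ($x_t=f_t^{\mathrm{Tx}}(m,e^t)$), a charger function $f^{\mathrm C}:\mathcal M\to\mathcal E^n$ ($E^n=f^{\mathrm C}(M)$), and a decoder $\mathcal Y^n\to\mathcal M$ giving $\hat M$, such that the energy constraints and the cost constraint hold for every message. The error probability is $P_e=|\mathcal M|^{-1}\sum_m\Pr(\hat M\ne m\mid m\text{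 sent})$; $R$ is achievable if there is a sequence of $(R,n)$ codes with $P_e\to0$; $C_M(\Gamma)$ is the supremum of achievable rates. *)

theory Defs
  imports "HOL-Probability.Probability" "HOL-Library.NList"
begin

text \<open>
  A remotely powered channel: a discrete memoryless channel whose transmitter draws
  the energy \<open>energy_cost x\<close> of every input symbol \<open>x\<close> from a battery of size \<open>bmax\<close>,
  initially full, which a charger replenishes with amounts from \<open>energies\<close>.
\<close>

record ('x, 'y) rp_channel =
  inputs :: "'x set"
  outputs :: "'y set"
  energies :: "real set"
  kernel :: "'x \<Rightarrow> 'y pmf"
  energy_cost :: "'x \<Rightarrow> real"
  bmax :: real

text \<open>
  Sequences are lists, so the element at list position \<open>t\<close> belongs to time \<open>t + 1\<close>, and
  \<open>battery Ch es xs t\<close> is the battery level \<open>B\<^sub>t\<^sub>+\<^sub>1\<close> before the charging step of time \<open>t + 1\<close>.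
\<close>

primrec battery :: "('x, 'y) rp_channel \<Rightarrow> real list \<Rightarrow> 'x list \<Rightarrow> nat \<Rightarrow> real" where
  "battery Ch es xs 0 = bmax Ch"
| "battery Ch es xs (Suc t) = min (battery Ch es xs t + es ! t) (bmax Ch) - energy_cost Ch (xs ! t)"

definition energy_feasible :: "('x, 'y) rp_channel \<Rightarrow> nat \<Rightarrow> real list \<Rightarrow> 'x list \<Rightarrow> bool" where
  "energy_feasible Ch n es xs \<longleftrightarrow>
     (\<forall>t<n. energy_cost Ch (xs ! t) \<le> min (battery Ch es xs t + es ! t) (bmax Ch))"

primrec channel_output :: "('x, 'y) rp_channel \<Rightarrow> 'x list \<Rightarrow> 'y list pmf" where
  "channel_output Ch [] = return_pmf []"
| "channel_output Ch (x # xs) =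
     bind_pmf (kernel Ch x) (\<lambda>y. map_pmf (\<lambda>ys. y # ys) (channel_output Ch xs))"

text \<open>
  Codes with a fully cognitive charger: the charger knows the message.  The transmitter
  function \<open>tx t m\<close> of time \<open>t \<in> {1..n}\<close> only sees the first \<open>t\<close> energies.
\<close>

record ('x, 'y) cognitive_code =
  tx :: "nat \<Rightarrow> nat \<Rightarrow> real list \<Rightarrow> 'x"
  charger :: "nat \<Rightarrow> real list"
  decoder :: "'y list \<Rightarrow> nat"

definition messages :: "real \<Rightarrow> nat \<Rightarrow> nat set" where
  "messages R n = {1..nat \<lceil>2 powr (real n * R)\<rceil>}"

definition codeword :: "('x, 'y) cognitive_code \<Rightarrow> nat \<Rightarrow> nat \<Rightarrow> 'x list" where
  "codeword c n m = map (\<lambda>t. tx c t m (take t (charger c m))) [1..<Suc n]"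

definition is_cognitive_code ::
  "('x, 'y) rp_channel \<Rightarrow> real \<Rightarrow> real \<Rightarrow> nat \<Rightarrow> ('x, 'y) cognitive_code \<Rightarrow> bool" where
  "is_cognitive_code Ch \<Gamma> R n c \<longleftrightarrow>
     (\<forall>m\<in>messages R n. \<forall>t\<in>{1..n}. \<forall>es\<in>nlists t (energies Ch). tx c t m es \<in> inputs Ch) \<and>
     (\<forall>m\<in>messages R n. charger c m \<in> nlists n (energies Ch)) \<and>
     (\<forall>ys\<in>nlists n (outputs Ch). decoder c ys \<in> messages R n) \<and>
     (\<forall>m\<in>messages R n. energy_feasible Ch n (charger c m) (codeword c n m)) \<and>
     (\<forall>m\<in>messages R n. (\<Sum>t<n. charger c m ! t) / real n \<le> \<Gamma>)"

definition error_prob ::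
  "('x, 'y) rp_channel \<Rightarrow> real \<Rightarrow> nat \<Rightarrow> ('x, 'y) cognitive_code \<Rightarrow> real" where
  "error_prob Ch R n c =
     (\<Sum>m\<in>messages R n.
        measure_pmf.prob (channel_output Ch (codeword c n m)) {ys. decoder c ys \<noteq> m})
     / real (card (messages R n))"

definition achievable_cognitive :: "('x, 'y) rp_channel \<Rightarrow> real \<Rightarrow> real \<Rightarrow> bool" where
  "achievable_cognitive Ch \<Gamma> R \<longleftrightarrow>
     (\<exists>c. (\<forall>n\<ge>1. is_cognitive_code Ch \<Gamma> R n (c n)) \<and> (\<lambda>n. error_prob Ch R n (c n)) \<longlonglongrightarrow> 0)"

text \<open>Rates are nonnegative.\<close>

definition capacity_cognitive :: "('x, 'y) rp_channel \<Rightarrow> real \<Rightarrow> real" where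
  "capacity_cognitive Ch \<Gamma> = Sup {R. 0 \<le> R \<and> achievable_cognitive Ch \<Gamma> R}"

definition noiseless_ternary :: "(nat, nat) rp_channel" where
  "noiseless_ternary =
     \<lparr>inputs = {0, 1, 2}, outputs = {0, 1, 2}, energies = {0, 2},
      kernel = return_pmf, energy_cost = real, bmax = 2\<rparr>"

end

theory Submission imports Defs begin

text \<open>
  Every charge refills the battery completely, so it is optimal to charge lazily, i.e. only
  when the next symbol cannot be paid for. The channel being noiseless, the capacity is the
  exponential growth rate of the number of ternary words needing at most \<open>\<Gamma> n / 2\<close> lazy
  charges. Giving weight \<open>w\<close> to each charge, the words of length \<open>n\<close> have total weight of
  order \<open>\<lambda>(w)\<^sup>n\<close>, where \<open>\<lambda>(w)\<close> is the larger root of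
  \<open>\<lambda>\<^sup>2 - (2 + w) \<lambda> + 1 - w\<^sup>2\<close>. This gives the upper bound
  \<open>log \<lambda>(w) - \<Gamma>/2 log w\<close> for each \<open>0 < w \<le> 1\<close>; a Chernoff bound on both tails shows that the
  weight concentrates on words with about \<open>n w \<lambda>'(w)/\<lambda>(w)\<close> charges, so the bound is attained
  where \<open>w \<lambda>'(w)/\<lambda>(w) = \<Gamma>/2\<close>. The substitution \<open>w = 4 / (\<zeta>\<^sup>2 - 5)\<close> removes the square
  root from \<open>\<lambda>(w)\<close> and turns the stationarity condition into the cubic equation.
\<close>

subsection \<open>Lazy charging\<close>

text \<open>Together with the unfolding of \<open>nlists_def\<close> these rules make the simplifier loop.\<close>
declare nlistsE_length [simp del] nlistsE_set [simp del]

abbreviation ternary :: "nat set" where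
  "ternary \<equiv> {0, 1, 2}"

text \<open>A charge of 2 fills the battery from any level, hence the restart at
  \<open>2 - x\<close>; integer levels suffice for the lazy policy.\<close>

fun charges :: "nat \<Rightarrow> nat list \<Rightarrow> nat" where
  "charges b [] = 0"
| "charges b (x # xs) = (if x \<le> b then charges (b - x) xs else Suc (charges (2 - x) xs))"

text \<open>The recursion of \<open>battery\<close> with an arbitrary initial level, so that an
  induction on the word can peel off its first symbol.\<close>

primrec level :: "real \<Rightarrow> real list \<Rightarrow> nat list \<Rightarrow> nat \<Rightarrow> real" where
  "level b es xs 0 = b"
| "level b es xs (Suc t) = min (level b es xs t + es ! t) 2 - real (xs ! t)"

definition feasible_from :: "real \<Rightarrow> real list \<Rightarrow> nat list \<Rightarrow> bool" where
  "feasible_from b es xs \<longleftrightarrow> (\<forall>t<length xs. real (xs ! t) \<le> min (level b es xs t + es ! t) 2)"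

lemma battery_noiseless_ternary: "battery noiseless_ternary es xs t = level 2 es xs t"
  by (induction t) (auto simp: noiseless_ternary_def)

lemma energy_feasible_noiseless_ternary:
  "energy_feasible noiseless_ternary (length xs) es xs \<longleftrightarrow> feasible_from 2 es xs"
  unfolding energy_feasible_def feasible_from_def battery_noiseless_ternary
  by (simp add: noiseless_ternary_def)

lemma level_Cons:
  "level b (e # es) (x # xs) (Suc t) = level (min (b + e) 2 - real x) es xs t"
  by (induction t) auto

lemma feasible_from_Nil [simp]: "feasible_from b es []"
  by (simp add: feasible_from_def)

lemma feasible_from_Cons [simp]:
  "feasible_from b (e # es) (x # xs) \<longleftrightarrow>
     real x \<le> min (b + e) 2 \<and> feasible_from (min (b + e) 2 - real x) es xs"
  unfolding feasible_from_def length_Cons All_less_Suc2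
  by (simp del: level.simps(2) add: level_Cons)

text \<open>
  The second conjunct, for an arbitrary level \<open>B\<close>, covers the times after the charger has
  charged earlier than the lazy one: it is then one charge ahead.
\<close>
lemma charges_le_feasible_aux:
  assumes "feasible_from B es xs" "length es = length xs" "set es \<subseteq> {0, 2}" "B \<le> 2" "b \<le> 2"
  shows "(B \<le> real b \<longrightarrow> 2 * real (charges b xs) \<le> sum_list es) \<and>
         2 * real (charges b xs) \<le> 2 + sum_list es"
  using assms
proof (induction xs arbitrary: B es b)
  case Nil
  then show ?case by simp
next
  case (Cons x xs)
  obtain e es' where es: "es = e # es'"
    using Cons.prems(2) by (cases es) auto
  define B' where "B' = min (B + e) 2 - real x"
  have e: "e = 0 \<or> e = 2" and x: "real x \<le> min (B + e) 2"
    and prems: "feasible_from B' es' xs" "length es' = length xs" "set es' \<subseteq> {0, 2}" "B' \<le> 2"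
    using Cons.prems es by (auto simp: B'_def)
  have x2: "x \<le> 2" using x by simp
  note IH = Cons.IH[OF prems]
  \<comment> \<open>Whatever was charged before, the capacity bounds the level after
    \<open>x\<close> by \<open>2 - x\<close>, the level at which the lazy policy continues after a
    charge.\<close>
  have IH1: "2 * real (charges (2 - x) xs) \<le> sum_list es'"
  proof -
    have "B' \<le> real (2 - x)" using x2 by (simp add: B'_def of_nat_diff)
    then show ?thesis using IH[of "2 - x"] by simp
  qed
  show ?case
  proof (cases "x \<le> b")
    case True
    have "b - x \<le> 2" using Cons.prems by simp
    note IH2 = IH[OF this]
    \<comment> \<open>Without a charge the order of the two levels persists. If
      \<open>e = 2\<close>, the charge itself pays for the extra 2 in the second part of the
      induction hypothesis.\<close>
    have "B' \<le> real (b - x)" if "B \<le> real b" "e = 0"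
      using that True by (auto simp: B'_def of_nat_diff)
    with IH2 e True show ?thesis by (auto simp: es)
  next
    case False
    \<comment> \<open>A forced lazy charge is forced for the other charger too, whose level is no
      higher.\<close>
    have "e = 2" if "B \<le> real b"
      using that False x e by auto
    with IH1 e False show ?thesis by (auto simp: es)
  qed
qed

lemma charges_le_feasible:
  assumes "feasible_from 2 es xs" "length es = length xs" "set es \<subseteq> {0, 2}"
  shows "2 * real (charges 2 xs) \<le> sum_list es"
  using charges_le_feasible_aux[OF assms, of 2] by simp

text \<open>The lazy policy is realised by sending 2 exactly at the steps counted by
  \<open>charges\<close>; since no symbol exceeds 2, a full battery always covers the next
  one.\<close>

lemma lazy_charging_feasible:
  assumes "set xs \<subseteq> ternary" "b \<le> 2"
  shows "\<exists>es. length es = length xs \<and> set es \<subseteq> {0, 2} \<and> feasible_from (real b) es xs \<and>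
           sum_list es = 2 * real (charges b xs)"
  using assms
proof (induction xs arbitrary: b)
  case Nil
  then show ?case by auto
next
  case (Cons x xs)
  have x2: "x \<le> 2" "set xs \<subseteq> ternary" using Cons.prems by auto
  show ?case
  proof (cases "x \<le> b")
    case True
    obtain es where "length es = length xs" "set es \<subseteq> {0, 2}" "feasible_from (real (b - x)) es xs"
      "sum_list es = 2 * real (charges (b - x) xs)"
      using Cons.IH[of "b - x"] x2 Cons.prems by force
    with True Cons.prems show ?thesis
      by (intro exI[of _ "0 # es"]) (auto simp: of_nat_diff min_def)
  next
    case False
    obtain es where "length es = length xs" "set es \<subseteq> {0, 2}" "feasible_from (real (2 - x)) es xs"
      "sum_list es = 2 * real (charges (2 - x) xs)"
      using Cons.IH[of "2 - x"] x2 by force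
    with False x2 show ?thesis
      by (intro exI[of _ "2 # es"]) (auto simp: of_nat_diff min_def)
  qed
qed

text \<open>By \<open>affordableI\<close> and \<open>affordableE\<close> these are, for
  \<open>n \<ge> 1\<close>, exactly the words that some charging sequence supports within the cost
  constraint. Coding is thereby reduced to counting them.\<close>

definition affordable :: "real \<Rightarrow> nat \<Rightarrow> nat list set" where
  "affordable \<Gamma> n = {xs \<in> nlists n ternary. 2 * real (charges 2 xs) \<le> \<Gamma> * real n}"

lemma finite_nlists_ternary: "finite (nlists n ternary)"
  using finite_lists_length_eq[of ternary n] by (simp add: nlists_def conj_commute)

lemma finite_affordable: "finite (affordable \<Gamma> n)"
  using finite_nlists_ternary by (simp add: affordable_def)

lemma affordableI:
  assumes "n \<ge> 1" "xs \<in> nlists n ternary" "es \<in> nlists n {0, 2}"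
    "energy_feasible noiseless_ternary n es xs" "(\<Sum>t<n. es ! t) / real n \<le> \<Gamma>"
  shows "xs \<in> affordable \<Gamma> n"
proof -
  have len: "length xs = n" "length es = n" "set es \<subseteq> {0, 2}"
    using assms by (auto simp: nlists_def)
  have "2 * real (charges 2 xs) \<le> sum_list es"
    using charges_le_feasible assms(4) len energy_feasible_noiseless_ternary by metis
  also have "\<dots> \<le> \<Gamma> * real n"
    using assms(1,5) len by (simp add: sum_list_sum_nth atLeast0LessThan field_simps)
  finally show ?thesis using assms by (simp add: affordable_def)
qed

lemma affordableE:
  assumes "xs \<in> affordable \<Gamma> n" "n \<ge> 1"
  obtains es where "es \<in> nlists n {0, 2}" "energy_feasible noiseless_ternary n es xs"
    "(\<Sum>t<n. es ! t) / real n \<le> \<Gamma>"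
proof -
  have xs: "length xs = n" "set xs \<subseteq> ternary" "2 * real (charges 2 xs) \<le> \<Gamma> * real n"
    using assms by (auto simp: affordable_def nlists_def)
  obtain es where es: "length es = n" "set es \<subseteq> {0, 2}" "feasible_from 2 es xs"
    "sum_list es = 2 * real (charges 2 xs)"
    using lazy_charging_feasible[OF xs(2), of 2] xs(1) by auto
  show ?thesis
  proof (rule that)
    show "es \<in> nlists n {0, 2}" using es by (simp add: nlists_def)
    show "energy_feasible noiseless_ternary n es xs"
      using es energy_feasible_noiseless_ternary xs by metis
    show "(\<Sum>t<n. es ! t) / real n \<le> \<Gamma>"
      using es xs assms(2) by (simp add: sum_list_sum_nth atLeast0LessThan field_simps)
  qed
qed

lemma replicate_0_affordable:
  assumes "\<Gamma> \<ge> 0"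
  shows "replicate n 0 \<in> affordable \<Gamma> n"
proof -
  have "charges 2 (replicate n 0) = 0" by (induction n) auto
  then show ?thesis using assms by (auto simp: affordable_def nlists_def)
qed

subsection \<open>Codes and affordable words\<close>

lemma channel_output_noiseless_ternary: "channel_output noiseless_ternary xs = return_pmf xs"
proof (induction xs)
  case (Cons x xs)
  then show ?case by (simp add: noiseless_ternary_def bind_return_pmf)
qed simp

lemma finite_messages [simp]: "finite (messages R n)"
  by (simp add: messages_def)

lemma card_messages: "card (messages R n) = nat \<lceil>2 powr (real n * R)\<rceil>"
  by (simp add: messages_def)

lemma card_messages_pos: "card (messages R n) > 0"
  by (simp add: card_messages)

lemma one_in_messages: "1 \<in> messages R n"
proof -
  have "1 \<le> nat \<lceil>2 powr (real n * R)\<rceil>"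
    using card_messages_pos[of R n] unfolding card_messages by linarith
  then show ?thesis by (simp only: messages_def atLeastAtMost_iff order_refl simp_thms)
qed

lemma error_prob_noiseless_ternary:
  "error_prob noiseless_ternary R n c =
     1 - real (card {m \<in> messages R n. decoder c (codeword c n m) = m}) / real (card (messages R n))"
proof -
  let ?M = "messages R n" and ?D = "\<lambda>m. decoder c (codeword c n m)"
  have "(\<Sum>m\<in>?M. measure_pmf.prob (channel_output noiseless_ternary (codeword c n m)) {ys. decoder c ys \<noteq> m})
     = (\<Sum>m\<in>?M. 1 - of_bool (?D m = m))"
    unfolding channel_output_noiseless_ternary by (intro sum.cong) (auto simp: measure_return_pmf)
  also have "\<dots> = real (card ?M) - real (card {m \<in> ?M. ?D m = m})"
    by (simp add: sum_subtractf sum.If_cases of_bool_def Int_def)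
  finally show ?thesis
    using one_in_messages[of R n] by (auto simp: error_prob_def diff_divide_distrib)
qed

lemma codeword_affordable:
  assumes "is_cognitive_code noiseless_ternary \<Gamma> R n c" "m \<in> messages R n" "n \<ge> 1"
  shows "codeword c n m \<in> affordable \<Gamma> n"
proof (rule affordableI)
  have ch: "charger c m \<in> nlists n {0, 2}"
    using assms by (auto simp: is_cognitive_code_def noiseless_ternary_def)
  have "tx c t m (take t (charger c m)) \<in> ternary" if "t \<in> {1..n}" for t
  proof -
    have "take t (charger c m) \<in> nlists t {0, 2}"
      using ch that set_take_subset[of t "charger c m"] by (auto simp: nlists_def)
    then show ?thesis
      using assms that by (force simp: is_cognitive_code_def noiseless_ternary_def)
  qed
  then show "codeword c n m \<in> nlists n ternary"
    by (force simp: codeword_def nlists_def)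
  show "charger c m \<in> nlists n {0, 2}" by fact
  show "energy_feasible noiseless_ternary n (charger c m) (codeword c n m)"
    "(\<Sum>t<n. charger c m ! t) / real n \<le> \<Gamma>"
    using assms by (auto simp: is_cognitive_code_def)
qed (use assms in auto)

text \<open>Without noise, correctly decoded messages have distinct codewords, all of them
  affordable, so there are at most \<open>card (affordable \<Gamma> n)\<close> such
  messages.\<close>

lemma error_prob_ge:
  assumes "is_cognitive_code noiseless_ternary \<Gamma> R n c" "n \<ge> 1"
  shows "error_prob noiseless_ternary R n c \<ge>
     1 - real (card (affordable \<Gamma> n)) / 2 powr (real n * R)"
proof -
  let ?G = "{m \<in> messages R n. decoder c (codeword c n m) = m}"
  have "inj_on (codeword c n) ?G"
    by (rule inj_on_inverseI[of _ "decoder c"]) auto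
  then have "card ?G \<le> card (affordable \<Gamma> n)"
    by (rule card_inj_on_le) (use codeword_affordable assms finite_affordable in auto)
  moreover have "2 powr (real n * R) \<le> real (card (messages R n))"
    by (simp add: card_messages)
  ultimately show ?thesis
    unfolding error_prob_noiseless_ternary by (simp add: frac_le)
qed

text \<open>Any assignment of affordable words to messages yields a valid code, injective or not;
  this also supplies codes for the lengths at which the messages outnumber the affordable
  words.\<close>

lemma ex_cognitive_code:
  assumes n: "n \<ge> 1" and f: "f ` messages R n \<subseteq> affordable \<Gamma> n"
  shows "\<exists>c. is_cognitive_code noiseless_ternary \<Gamma> R n c \<and>
    (inj_on f (messages R n) \<longrightarrow> error_prob noiseless_ternary R n c = 0)"
proof -
  let ?M = "messages R n"
  have "\<forall>m. \<exists>es. m \<in> ?M \<longrightarrow> es \<in> nlists n {0, 2} \<and> energy_feasible noiseless_ternary n es (f m) \<and>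
    (\<Sum>t<n. es ! t) / real n \<le> \<Gamma>"
    using affordableE[OF _ n] f by (metis image_subset_iff)
  then obtain E where E: "\<And>m. m \<in> ?M \<Longrightarrow> E m \<in> nlists n {0, 2} \<and>
    energy_feasible noiseless_ternary n (E m) (f m) \<and> (\<Sum>t<n. E m ! t) / real n \<le> \<Gamma>"
    by metis
  \<comment> \<open>Times start at 1 and list positions at 0, hence \<open>t - 1\<close>. The
    default 1 of the decoder is always a message.\<close>
  define c :: "(nat, nat) cognitive_code" where
    "c = \<lparr>tx = (\<lambda>t m es. f m ! (t - 1)), charger = E,
          decoder = (\<lambda>ys. if ys \<in> f ` ?M then inv_into ?M f ys else 1)\<rparr>"
  have fm: "length (f m) = n" "set (f m) \<subseteq> ternary" if "m \<in> ?M" for m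
    using that f by (auto simp: affordable_def nlists_def image_subset_iff)
  have cw: "codeword c n m = f m" if "m \<in> ?M" for m
    using fm[OF that]
    by (intro nth_equalityI) (auto simp: codeword_def c_def simp del: upt_Suc)
  have "is_cognitive_code noiseless_ternary \<Gamma> R n c"
    unfolding is_cognitive_code_def
  proof (intro conjI ballI)
    fix m t es assume m: "m \<in> ?M" and t: "t \<in> {1..n}"
    have "f m ! (t - 1) \<in> set (f m)"
      using t fm[OF m] by (intro nth_mem) auto
    then show "tx c t m es \<in> inputs noiseless_ternary"
      using fm[OF m] by (auto simp: c_def noiseless_ternary_def)
  next
    fix ys
    show "decoder c ys \<in> ?M"
      using one_in_messages by (auto simp: c_def inv_into_into)
  next
    fix m assume m: "m \<in> ?M"
    show "charger c m \<in> nlists n (energies noiseless_ternary)"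
      "energy_feasible noiseless_ternary n (charger c m) (codeword c n m)"
      "(\<Sum>t<n. charger c m ! t) / real n \<le> \<Gamma>"
      using E[OF m] cw[OF m] by (simp_all add: c_def noiseless_ternary_def)
  qed
  moreover have "error_prob noiseless_ternary R n c = 0" if "inj_on f ?M"
  proof -
    have "{m \<in> ?M. decoder c (codeword c n m) = m} = ?M"
      using that by (auto simp: cw) (auto simp: c_def)
    then show ?thesis
      using one_in_messages[of R n] by (auto simp: error_prob_noiseless_ternary)
  qed
  ultimately show ?thesis by blast
qed

lemma achievable_cognitiveI:
  assumes "\<Gamma> \<ge> 0"
    and "eventually (\<lambda>n. card (messages R n) \<le> card (affordable \<Gamma> n)) sequentially"
  shows "achievable_cognitive noiseless_ternary \<Gamma> R"
proof -
  have "\<exists>c. n \<ge> 1 \<longrightarrow> is_cognitive_code noiseless_ternary \<Gamma> R n c \<and>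
    (card (messages R n) \<le> card (affordable \<Gamma> n) \<longrightarrow> error_prob noiseless_ternary R n c = 0)" for n
  proof (cases "card (messages R n) \<le> card (affordable \<Gamma> n)")
    case True
    then obtain f where "f ` messages R n \<subseteq> affordable \<Gamma> n" "inj_on f (messages R n)"
      using card_le_inj[OF finite_messages finite_affordable] by blast
    then show ?thesis using ex_cognitive_code by blast
  next
    case False
    \<comment> \<open>Achievability asks for a code at every length, so the bad lengths receive the
      constant all-zero codeword.\<close>
    have "(\<lambda>_. replicate n 0) ` messages R n \<subseteq> affordable \<Gamma> n"
      using replicate_0_affordable[OF assms(1)] by auto
    then show ?thesis using ex_cognitive_code False by blast
  qed
  then obtain c where c: "\<And>n. n \<ge> 1 \<Longrightarrow> is_cognitive_code noiseless_ternary \<Gamma> R n (c n)"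
    "\<And>n. n \<ge> 1 \<Longrightarrow> card (messages R n) \<le> card (affordable \<Gamma> n) \<Longrightarrow>
      error_prob noiseless_ternary R n (c n) = 0"
    by metis
  have "eventually (\<lambda>n. error_prob noiseless_ternary R n (c n) = 0) sequentially"
    using assms(2) eventually_ge_at_top[of 1] by eventually_elim (use c in auto)
  then have "(\<lambda>n. error_prob noiseless_ternary R n (c n)) \<longlonglongrightarrow> 0"
    by (rule tendsto_eventually)
  with c show ?thesis unfolding achievable_cognitive_def by blast
qed

subsection \<open>The weight of all words\<close>

text \<open>The generating function of the number of lazy charges over all ternary words, by initial
  level.\<close>

definition weight_sum :: "nat \<Rightarrow> nat \<Rightarrow> real \<Rightarrow> real" where
  "weight_sum b n w = (\<Sum>xs\<in>nlists n ternary. w ^ charges b xs)"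

lemma weight_sum_0 [simp]: "weight_sum b 0 w = 1"
  by (simp add: weight_sum_def)

lemma weight_sum_Suc_aux:
  "weight_sum b (Suc n) w =
     (\<Sum>x\<in>ternary. if x \<le> b then weight_sum (b - x) n w else w * weight_sum (2 - x) n w)"
proof -
  have "weight_sum b (Suc n) w =
      (\<Sum>x\<in>ternary. \<Sum>xs\<in>(#) x ` nlists n ternary. w ^ charges b xs)"
    unfolding weight_sum_def nlists_Suc
    by (rule sum.UNION_disjoint) (use finite_nlists_ternary in auto)
  also have "\<dots> = (\<Sum>x\<in>ternary. \<Sum>xs\<in>nlists n ternary. w ^ charges b (x # xs))"
    by (rule sum.cong[OF refl]) (simp add: sum.reindex)
  also have "\<dots> = (\<Sum>x\<in>ternary.
      if x \<le> b then weight_sum (b - x) n w else w * weight_sum (2 - x) n w)"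
    by (intro sum.cong refl) (simp add: weight_sum_def sum_distrib_left)
  finally show ?thesis .
qed

lemma weight_sum_Suc:
  "weight_sum 0 (Suc n) w = (1 + w) * weight_sum 0 n w + w * weight_sum 1 n w"
  "weight_sum 1 (Suc n) w = (1 + w) * weight_sum 0 n w + weight_sum 1 n w"
  "weight_sum 2 (Suc n) w = weight_sum 0 n w + weight_sum 1 n w + weight_sum 2 n w"
  by (simp_all add: weight_sum_Suc_aux algebra_simps)

text \<open>The larger eigenvalue of the matrix by which \<open>weight_sum_Suc\<close> acts on
  levels 0 and 1. Level 2 only adds the eigenvalue 1, which is smaller for
  \<open>w > 0\<close>.\<close>

definition growth :: "real \<Rightarrow> real" where
  "growth w = (2 + w + sqrt (4 * w + 5 * w ^ 2)) / 2"

lemma growth_gt: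
  assumes "w > 0"
  shows "growth w > 1 + w"
proof -
  have "w < sqrt (4 * w + 5 * w ^ 2)"
    by (rule real_less_rsqrt) (use assms in \<open>simp add: add_pos_pos\<close>)
  then show ?thesis by (simp add: growth_def)
qed

lemma growth_char_poly:
  assumes "w > 0"
  shows "(growth w - 1) * (growth w - 1 - w) = w * (1 + w)"
proof -
  define r where "r = sqrt (4 * w + 5 * w ^ 2)"
  have "r ^ 2 = 4 * w + 5 * w ^ 2"
    using assms by (simp add: r_def)
  then show ?thesis
    unfolding growth_def r_def[symmetric] by (simp add: field_simps power2_eq_square)
qed

text \<open>The recursion has nonnegative coefficients and a positive eigenvector for the eigenvalue
  \<open>growth w\<close>. Comparison with multiples of that eigenvector is preserved from
  \<open>n\<close> to \<open>Suc n\<close>.\<close>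

lemma weight_sum_bounds:
  assumes "w > 0"
  obtains c C where "c > 0" "\<And>n. c * growth w ^ n \<le> weight_sum 2 n w"
    "\<And>n. weight_sum 2 n w \<le> C * growth w ^ n"
proof -
  define l where "l = growth w"
  have l: "l > 1 + w" "(l - 1) * (l - 1 - w) = w * (1 + w)"
    using growth_gt[OF assms] growth_char_poly[OF assms] by (auto simp: l_def)
  \<comment> \<open>The Perron eigenvector of the recursion \<open>weight_sum_Suc\<close>.\<close>
  define v0 v1 v2 where "v0 = l - 1" and "v1 = 1 + w" and "v2 = (l + w) / (l - 1)"
  have v_pos: "v0 > 0" "v1 > 0" "v2 > 0"
    using l assms by (auto simp: v0_def v1_def v2_def)
  have eig: "(1 + w) * v0 + w * v1 = l * v0" "(1 + w) * v0 + v1 = l * v1" "v0 + v1 + v2 = l * v2"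
    using l assms by (auto simp: v0_def v1_def v2_def field_simps)
  have step: "k * v * l ^ Suc n = k * (l * v) * l ^ n" for k v n by simp
  have eq: "k * v0 * l ^ Suc n = (1 + w) * (k * v0 * l ^ n) + w * (k * v1 * l ^ n)"
    "k * v1 * l ^ Suc n = (1 + w) * (k * v0 * l ^ n) + k * v1 * l ^ n"
    "k * v2 * l ^ Suc n = k * v0 * l ^ n + k * v1 * l ^ n + k * v2 * l ^ n" for k n
    unfolding step eig[symmetric] by (simp_all add: algebra_simps)
  have upper: "weight_sum 0 n w \<le> k * v0 * l ^ n \<and> weight_sum 1 n w \<le> k * v1 * l ^ n \<and>
      weight_sum 2 n w \<le> k * v2 * l ^ n" if "1 \<le> k * v0" "1 \<le> k * v1" "1 \<le> k * v2" for k n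
  proof (induction n)
    case (Suc n)
    show ?case unfolding eq weight_sum_Suc
      using Suc assms by (intro conjI add_mono mult_left_mono) auto
  qed (use that in auto)
  have lower: "k * v0 * l ^ n \<le> weight_sum 0 n w \<and> k * v1 * l ^ n \<le> weight_sum 1 n w \<and>
      k * v2 * l ^ n \<le> weight_sum 2 n w" if "k * v0 \<le> 1" "k * v1 \<le> 1" "k * v2 \<le> 1" for k n
  proof (induction n)
    case (Suc n)
    show ?case unfolding eq weight_sum_Suc
      using Suc assms by (intro conjI add_mono mult_left_mono) auto
  qed (use that in auto)
  \<comment> \<open>All initial values are 1, so the multiples of the eigenvector must lie below 1
    and above 1 in every component.\<close>
  define a A where "a = 1 / (v0 + v1 + v2)" and "A = 1 / v0 + 1 / v1 + 1 / v2"
  have a: "a * v0 \<le> 1" "a * v1 \<le> 1" "a * v2 \<le> 1" "a * v2 > 0"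
    using v_pos by (auto simp: a_def field_simps)
  have A: "1 \<le> A * v0" "1 \<le> A * v1" "1 \<le> A * v2"
    using v_pos by (auto simp: A_def distrib_right)
  show ?thesis
    using that[of "a * v2" "A * v2"] a upper[OF A] lower[OF a(1-3)] by (simp add: l_def)
qed

subsection \<open>Concentration of the weight\<close>

text \<open>The logarithmic derivative \<open>w \<lambda>'(w) / \<lambda>(w)\<close> of \<open>\<lambda> = growth\<close>.\<close>
definition mean_rate :: "real \<Rightarrow> real" where
  "mean_rate w = w * ((1 + (2 + 5 * w) / sqrt (4 * w + 5 * w ^ 2)) / 2) / growth w"

lemma DERIV_ln_growth_exp:
  assumes "w > 0"
  shows "((\<lambda>s. ln (growth (w * exp s))) has_real_derivative mean_rate w) (at 0)"
proof -
  have pos: "4 * w + 5 * w ^ 2 > 0"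
    using assms by (simp add: add_pos_pos)
  have sqrt: "((\<lambda>w. sqrt (4 * w + 5 * w ^ 2)) has_real_derivative
      (inverse (sqrt (4 * w + 5 * w ^ 2)) / 2) * (4 + 10 * w)) (at w)"
    using pos by (auto intro!: derivative_eq_intros)
  have growth: "(growth has_real_derivative
      (1 + (2 + 5 * w) / sqrt (4 * w + 5 * w ^ 2)) / 2) (at w)"
  proof -
    have "((\<lambda>w. (2 + w + sqrt (4 * w + 5 * w ^ 2)) / 2) has_real_derivative
        (0 + 1 + inverse (sqrt (4 * w + 5 * w ^ 2)) / 2 * (4 + 10 * w)) / 2) (at w)"
      by (intro DERIV_cdivide DERIV_add DERIV_const DERIV_ident sqrt)
    moreover have "inverse r / 2 * (4 + 10 * w) = (2 + 5 * w) / r" for r :: real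
      by (cases "r = 0") (simp_all add: field_simps)
    ultimately show ?thesis unfolding growth_def[abs_def] by (simp only: add_0_left)
  qed
  have "((\<lambda>s. w * exp s) has_real_derivative w) (at 0)"
    by (auto intro!: derivative_eq_intros)
  then have "((\<lambda>s. growth (w * exp s)) has_real_derivative
      (1 + (2 + 5 * w) / sqrt (4 * w + 5 * w ^ 2)) / 2 * w) (at 0)"
    using growth by (intro DERIV_chain2[where f = growth]) auto
  moreover have "growth w > 0" using growth_gt[OF assms] assms by simp
  ultimately show ?thesis
    unfolding mean_rate_def by (auto intro!: derivative_eq_intros simp: field_simps)
qed

text \<open>The logarithm of the left-hand side, as a function of \<open>h\<close>, has slope
  \<open>mean_rate w - \<alpha>\<close> at 0. This is nonzero, so a small step \<open>h\<close> with
  the sign of \<open>\<alpha> - mean_rate w\<close> decreases it.\<close>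

lemma growth_tilt_less:
  assumes "w > 0" "\<alpha> \<noteq> mean_rate w"
  obtains h where "h * (\<alpha> - mean_rate w) > 0" "growth (w * exp h) * exp (- h * \<alpha>) < growth w"
proof -
  define \<phi> where "\<phi> = (\<lambda>s. ln (growth (w * exp s)) - \<alpha> * s)"
  have deriv: "(\<phi> has_real_derivative mean_rate w - \<alpha>) (at 0)"
    unfolding \<phi>_def
    using DERIV_diff[OF DERIV_ln_growth_exp[OF assms(1)] DERIV_cmult_Id[of \<alpha>]] by simp
  have "\<exists>h. h * (\<alpha> - mean_rate w) > 0 \<and> \<phi> h < \<phi> 0"
  proof (cases "\<alpha> > mean_rate w")
    case True
    then obtain d where d: "d > 0" "\<And>h. 0 < h \<Longrightarrow> h < d \<Longrightarrow> \<phi> h < \<phi> 0"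
      using DERIV_neg_dec_right[OF deriv] by auto
    then show ?thesis using True by (intro exI[of _ "d / 2"]) auto
  next
    case False
    then obtain d where d: "d > 0" "\<And>h. 0 < h \<Longrightarrow> h < d \<Longrightarrow> \<phi> (- h) < \<phi> 0"
      using DERIV_pos_inc_left[OF deriv] assms by auto
    then show ?thesis using False assms by (intro exI[of _ "- (d / 2)"]) (auto simp: mult_less_0_iff)
  qed
  then obtain h where h: "h * (\<alpha> - mean_rate w) > 0" "\<phi> h < \<phi> 0" by blast
  have pos: "growth (w * exp s) > 0" for s
    using growth_gt[of "w * exp s"] assms by (smt (verit) exp_gt_zero mult_pos_pos)
  have "exp (\<phi> h) < exp (\<phi> 0)" using h by simp
  then have "growth (w * exp h) * exp (- h * \<alpha>) < growth w"
    using pos[of h] pos[of 0] by (simp add: \<phi>_def exp_diff exp_minus field_simps)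
  with h show ?thesis using that by blast
qed

text \<open>The upper tail for \<open>h > 0\<close>, the lower tail for \<open>h < 0\<close>.\<close>
lemma weight_tail_le:
  assumes "w > 0"
  shows "(\<Sum>xs\<in>{xs \<in> nlists n ternary. h * a \<le> h * real (charges 2 xs)}. w ^ charges 2 xs)
    \<le> exp (- h * a) * weight_sum 2 n (w * exp h)"
proof -
  have "(\<Sum>xs\<in>{xs \<in> nlists n ternary. h * a \<le> h * real (charges 2 xs)}. w ^ charges 2 xs)
    \<le> (\<Sum>xs\<in>{xs \<in> nlists n ternary. h * a \<le> h * real (charges 2 xs)}.
         exp (- h * a) * (w * exp h) ^ charges 2 xs)"
  proof (rule sum_mono)
    fix xs assume "xs \<in> {xs \<in> nlists n ternary. h * a \<le> h * real (charges 2 xs)}"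
    then have "1 \<le> exp (h * real (charges 2 xs) - h * a)" by simp
    then have "w ^ charges 2 xs * 1 \<le> w ^ charges 2 xs * exp (h * real (charges 2 xs) - h * a)"
      using assms by (intro mult_left_mono) auto
    also have "\<dots> = exp (- h * a) * (w * exp h) ^ charges 2 xs"
      by (simp add: exp_diff exp_minus power_mult_distrib exp_of_nat_mult field_simps
          flip: exp_of_nat2_mult)
    finally show "w ^ charges 2 xs \<le> exp (- h * a) * (w * exp h) ^ charges 2 xs" by simp
  qed
  also have "\<dots> \<le> (\<Sum>xs\<in>nlists n ternary. exp (- h * a) * (w * exp h) ^ charges 2 xs)"
    using assms finite_nlists_ternary by (intro sum_mono2) auto
  finally show ?thesis by (simp add: weight_sum_def sum_distrib_left)
qed

text \<open>The product condition covers both tails: the upper one for \<open>\<alpha>\<close> above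
  the mean rate, the lower one for \<open>\<alpha>\<close> below it. In either case the Chernoff
  bound with the tilt \<open>h\<close> of \<open>growth_tilt_less\<close> gives a growth strictly
  below that of the total weight.\<close>

lemma weight_tail_exponential:
  assumes "w > 0" "\<alpha> \<noteq> mean_rate w"
  shows "\<exists>r C. 0 \<le> r \<and> r < growth w \<and>
    (\<forall>n. (\<Sum>xs\<in>{xs \<in> nlists n ternary.
        0 \<le> (\<alpha> - mean_rate w) * (real (charges 2 xs) - \<alpha> * real n)}. w ^ charges 2 xs) \<le> C * r ^ n)"
proof -
  obtain h where h: "h * (\<alpha> - mean_rate w) > 0" "growth (w * exp h) * exp (- h * \<alpha>) < growth w"
    using growth_tilt_less[OF assms] .
  have wh: "w * exp h > 0" using assms by simp
  obtain C where C: "\<And>n. weight_sum 2 n (w * exp h) \<le> C * growth (w * exp h) ^ n"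
    using weight_sum_bounds[OF wh] by metis
  define r where "r = growth (w * exp h) * exp (- h * \<alpha>)"
  have set_eq: "{xs \<in> nlists n ternary. 0 \<le> (\<alpha> - mean_rate w) * (real (charges 2 xs) - \<alpha> * real n)}
    = {xs \<in> nlists n ternary. h * (\<alpha> * real n) \<le> h * real (charges 2 xs)}" for n
  proof (cases "h > 0")
    case True
    then show ?thesis using h by (auto simp: zero_less_mult_iff zero_le_mult_iff)
  next
    case False
    then show ?thesis using h by (auto simp: zero_less_mult_iff zero_le_mult_iff mult_le_cancel_left)
  qed
  have "(\<Sum>xs\<in>{xs \<in> nlists n ternary.
      0 \<le> (\<alpha> - mean_rate w) * (real (charges 2 xs) - \<alpha> * real n)}. w ^ charges 2 xs) \<le> C * r ^ n" for n
  proof -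
    have "exp (- h * (\<alpha> * real n)) * weight_sum 2 n (w * exp h)
        \<le> exp (- h * (\<alpha> * real n)) * (C * growth (w * exp h) ^ n)"
      using C by (intro mult_left_mono) auto
    also have "exp (- h * (\<alpha> * real n)) * (C * growth (w * exp h) ^ n) = C * r ^ n"
      by (simp add: r_def power_mult_distrib mult_ac flip: exp_of_nat_mult)
    finally show ?thesis
      unfolding set_eq by (rule order_trans[OF weight_tail_le[OF assms(1)]])
  qed
  moreover have "r \<ge> 0" using growth_gt[OF wh] wh by (simp add: r_def)
  moreover have "r < growth w" using h by (simp add: r_def)
  ultimately show ?thesis by blast
qed

subsection \<open>Bounds on the achievable rates\<close>

text \<open>As \<open>w \<le> 1\<close>, an affordable word has weight at least
  \<open>w powr (\<Gamma> * n / 2)\<close>; dividing the total weight by this bounds their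
  number.\<close>

lemma card_affordable_le:
  assumes "0 < w" "w \<le> 1"
  shows "real (card (affordable \<Gamma> n)) \<le> w powr (- (\<Gamma> * real n / 2)) * weight_sum 2 n w"
proof -
  have "real (card (affordable \<Gamma> n)) = (\<Sum>xs\<in>affordable \<Gamma> n. 1)" by simp
  also have "\<dots> \<le> (\<Sum>xs\<in>affordable \<Gamma> n. w powr (- (\<Gamma> * real n / 2)) * w ^ charges 2 xs)"
  proof (rule sum_mono)
    fix xs assume "xs \<in> affordable \<Gamma> n"
    then have "w powr 0 \<le> w powr (- (\<Gamma> * real n / 2) + real (charges 2 xs))"
      using assms by (intro powr_mono') (auto simp: affordable_def)
    then show "1 \<le> w powr (- (\<Gamma> * real n / 2)) * w ^ charges 2 xs"
      using assms by (simp only: powr_add powr_realpow powr_zero_eq_one simp_thms) simp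
  qed
  also have "\<dots> \<le> (\<Sum>xs\<in>nlists n ternary. w powr (- (\<Gamma> * real n / 2)) * w ^ charges 2 xs)"
    using assms finite_nlists_ternary by (intro sum_mono2) (auto simp: affordable_def)
  finally show ?thesis by (simp add: weight_sum_def sum_distrib_left)
qed

lemma achievable_cognitive_le:
  assumes "achievable_cognitive noiseless_ternary \<Gamma> R" "0 < w" "w \<le> 1"
  shows "R \<le> log 2 (growth w) - \<Gamma> / 2 * log 2 w"
proof (rule ccontr)
  assume R: "\<not> ?thesis"
  obtain C where C: "\<And>n. weight_sum 2 n w \<le> C * growth w ^ n"
    using weight_sum_bounds[OF assms(2)] by metis
  obtain c where c: "\<And>n. n \<ge> 1 \<Longrightarrow> is_cognitive_code noiseless_ternary \<Gamma> R n (c n)"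
    "(\<lambda>n. error_prob noiseless_ternary R n (c n)) \<longlonglongrightarrow> 0"
    using assms(1) by (auto simp: achievable_cognitive_def)
  have g: "growth w > 0" using growth_gt[OF assms(2)] assms by simp
  \<comment> \<open>Up to a constant, \<open>q ^ n\<close> bounds the number of affordable words per
    message. A rate above the claimed bound makes \<open>q < 1\<close>, which forces the error
    probability towards 1.\<close>
  define q where "q = growth w * w powr (- (\<Gamma> / 2)) / 2 powr R"
  have q0: "q > 0" using g assms by (simp add: q_def)
  have "log 2 q = log 2 (growth w) - \<Gamma> / 2 * log 2 w - R"
    using g assms by (simp add: q_def log_divide log_mult log_powr)
  then have "log 2 q < log 2 1" using R by simp
  then have q1: "q < 1" using q0 by (subst (asm) log_less_cancel_iff) auto
  have "(\<lambda>n. 1 - C * q ^ n) \<longlonglongrightarrow> 1 - C * 0"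
    using q0 q1 by (intro tendsto_intros LIMSEQ_power_zero) auto
  moreover have "eventually (\<lambda>n. 1 - C * q ^ n \<le> error_prob noiseless_ternary R n (c n)) sequentially"
    using eventually_ge_at_top[of 1]
  proof eventually_elim
    case (elim n)
    have "real (card (affordable \<Gamma> n)) \<le> w powr (- (\<Gamma> * real n / 2)) * (C * growth w ^ n)"
      using card_affordable_le[OF assms(2,3)] C[of n]
      by (meson mult_left_mono order_trans powr_ge_zero)
    also have "w powr (- (\<Gamma> * real n / 2)) = (w powr (- (\<Gamma> / 2))) ^ n"
      using assms by (simp add: powr_power mult_ac)
    finally have "real (card (affordable \<Gamma> n)) / 2 powr (real n * R) \<le>
        (w powr (- (\<Gamma> / 2))) ^ n * (C * growth w ^ n) / 2 powr (real n * R)"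
      by (intro divide_right_mono) auto
    also have "2 powr (real n * R) = (2 powr R) ^ n"
      by (simp add: powr_power mult_ac)
    also have "(w powr (- (\<Gamma> / 2))) ^ n * (C * growth w ^ n) / (2 powr R) ^ n = C * q ^ n"
      by (simp add: q_def power_mult_distrib power_divide)
    finally have "real (card (affordable \<Gamma> n)) / (2 powr R) ^ n \<le> C * q ^ n" .
    moreover have "1 - real (card (affordable \<Gamma> n)) / (2 powr R) ^ n
        \<le> error_prob noiseless_ternary R n (c n)"
      using error_prob_ge[OF c(1)[OF elim] elim] by (simp add: powr_power mult_ac)
    ultimately show ?case by linarith
  qed
  ultimately have "1 - C * 0 \<le> 0"
    using c(2) by (intro tendsto_le[OF sequentially_bot])
  then show False by simp
qed

text \<open>Words with close to \<open>mean_rate w * n\<close> charges carry almost all the weight,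
  and each weighs at most about \<open>w powr (mean_rate w * n)\<close>. Hence there are about
  \<open>(growth w / w powr mean_rate w) ^ n\<close> of them, and they are affordable because
  \<open>mean_rate w < \<Gamma> / 2\<close>.\<close>

lemma achievable_cognitive_below_rate:
  assumes w: "0 < w" "w \<le> 1" and \<Gamma>: "mean_rate w < \<Gamma> / 2"
    and R: "0 \<le> R" "R < log 2 (growth w) - mean_rate w * log 2 w"
  shows "achievable_cognitive noiseless_ternary \<Gamma> R"
proof -
  define \<mu> where "\<mu> = mean_rate w"
  have gpos: "growth w > 0" using growth_gt[OF w(1)] w by simp
  have "\<mu> \<ge> 0" using w gpos by (auto simp: \<mu>_def mean_rate_def)
  then have "\<Gamma> \<ge> 0" using \<Gamma> by (simp add: \<mu>_def)
  \<comment> \<open>The width \<open>\<delta>\<close> must be small enough that the rate still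
    exceeds \<open>R\<close> and that \<open>\<mu> + \<delta>\<close> stays below
    \<open>\<Gamma> / 2\<close>.\<close>
  have "((\<lambda>\<delta>. log 2 (growth w) - (\<mu> - \<delta>) * log 2 w) \<longlongrightarrow> log 2 (growth w) - (\<mu> - 0) * log 2 w) (at_right 0)"
    by (intro tendsto_intros)
  then have "eventually (\<lambda>\<delta>. R < log 2 (growth w) - (\<mu> - \<delta>) * log 2 w) (at_right 0)"
    using R by (intro order_tendstoD) (auto simp: \<mu>_def)
  moreover have "eventually (\<lambda>\<delta>. \<delta> \<in> {0<..<\<Gamma> / 2 - \<mu>}) (at_right 0)"
    using \<Gamma> by (intro eventually_at_right_real) (auto simp: \<mu>_def)
  ultimately have "eventually (\<lambda>\<delta>. R < log 2 (growth w) - (\<mu> - \<delta>) * log 2 w \<and>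
      \<delta> \<in> {0<..<\<Gamma> / 2 - \<mu>}) (at_right 0)"
    by (rule eventually_conj)
  then obtain \<delta> where \<delta>: "R < log 2 (growth w) - (\<mu> - \<delta>) * log 2 w" "\<delta> > 0" "\<delta> < \<Gamma> / 2 - \<mu>"
    using eventually_happens'[OF trivial_limit_at_right_real] by fastforce
  have up: "\<mu> + \<delta> \<noteq> mean_rate w" "\<mu> + \<delta> - mean_rate w = \<delta>"
    and down: "\<mu> - \<delta> \<noteq> mean_rate w" "\<mu> - \<delta> - mean_rate w = - \<delta>"
    using \<delta> by (auto simp: \<mu>_def)
  have iff: "0 \<le> \<delta> * y \<longleftrightarrow> 0 \<le> y" "0 \<le> - \<delta> * y \<longleftrightarrow> y \<le> 0" for y
    using \<delta> by (auto simp: zero_le_mult_iff mult_le_0_iff)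
  obtain r1 C1 where 1: "0 \<le> r1" "r1 < growth w"
    "\<And>n. (\<Sum>xs\<in>{xs \<in> nlists n ternary. (\<mu> + \<delta>) * real n \<le> real (charges 2 xs)}.
       w ^ charges 2 xs) \<le> C1 * r1 ^ n"
    using weight_tail_exponential[OF w(1) up(1)] unfolding up(2) iff diff_ge_0_iff_ge by blast
  obtain r2 C2 where 2: "0 \<le> r2" "r2 < growth w"
    "\<And>n. (\<Sum>xs\<in>{xs \<in> nlists n ternary. real (charges 2 xs) \<le> (\<mu> - \<delta>) * real n}.
       w ^ charges 2 xs) \<le> C2 * r2 ^ n"
    using weight_tail_exponential[OF w(1) down(1)] unfolding down(2) iff diff_le_0_iff_le by blast
  obtain c where c: "c > 0" "\<And>n. c * growth w ^ n \<le> weight_sum 2 n w"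
    using weight_sum_bounds[OF w(1)] by metis
  define \<rho> where "\<rho> = w powr (\<mu> - \<delta>)"
  have \<rho>: "\<rho> > 0" using w by (simp add: \<rho>_def)
  define q where "q = 2 powr R"
  have q: "q \<ge> 1" using R by (simp add: q_def ge_one_powr_ge_zero)
  \<comment> \<open>The total weight is split into the two tails and the middle, whose words are
    affordable and weigh at most \<open>\<rho> ^ n\<close> each.\<close>
  have main: "c * growth w ^ n \<le> C1 * r1 ^ n + C2 * r2 ^ n +
      real (card (affordable \<Gamma> n)) * \<rho> ^ n" for n
  proof -
    let ?H = "{xs \<in> nlists n ternary. (\<mu> + \<delta>) * real n \<le> real (charges 2 xs)}"
    let ?L = "{xs \<in> nlists n ternary. real (charges 2 xs) \<le> (\<mu> - \<delta>) * real n}"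
    let ?M = "nlists n ternary - ?H - ?L"
    note fin = finite_nlists_ternary[of n]
    have "nlists n ternary = (?H \<union> ?L) \<union> ?M" by auto
    then have "weight_sum 2 n w = (\<Sum>xs\<in>(?H \<union> ?L) \<union> ?M. w ^ charges 2 xs)"
      by (simp add: weight_sum_def)
    also have "\<dots> = (\<Sum>xs\<in>?H \<union> ?L. w ^ charges 2 xs) + (\<Sum>xs\<in>?M. w ^ charges 2 xs)"
      using fin by (intro sum.union_disjoint) auto
    finally have split: "weight_sum 2 n w =
        (\<Sum>xs\<in>?H \<union> ?L. w ^ charges 2 xs) + (\<Sum>xs\<in>?M. w ^ charges 2 xs)" .
    have tails: "(\<Sum>xs\<in>?H \<union> ?L. w ^ charges 2 xs) \<le>
        (\<Sum>xs\<in>?H. w ^ charges 2 xs) + (\<Sum>xs\<in>?L. w ^ charges 2 xs)"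
    proof -
      have "0 \<le> (\<Sum>xs\<in>?H \<inter> ?L. w ^ charges 2 xs)" using w by (intro sum_nonneg) auto
      then show ?thesis using fin by (subst sum_Un) auto
    qed
    have "(\<Sum>xs\<in>?M. w ^ charges 2 xs) \<le> (\<Sum>xs\<in>?M. \<rho> ^ n)"
    proof (rule sum_mono)
      fix xs assume "xs \<in> ?M"
      then have "(\<mu> - \<delta>) * real n \<le> real (charges 2 xs)" by force
      then have "w powr real (charges 2 xs) \<le> w powr ((\<mu> - \<delta>) * real n)"
        using w by (intro powr_mono') auto
      then show "w ^ charges 2 xs \<le> \<rho> ^ n"
        using w by (simp add: \<rho>_def powr_realpow powr_power mult_ac)
    qed
    also have "\<dots> \<le> (\<Sum>xs\<in>affordable \<Gamma> n. \<rho> ^ n)"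
    proof (rule sum_mono2)
      show "?M \<subseteq> affordable \<Gamma> n"
      proof
        fix xs assume xs: "xs \<in> ?M"
        then have "real (charges 2 xs) \<le> (\<mu> + \<delta>) * real n" by force
        also have "\<dots> \<le> \<Gamma> / 2 * real n"
          using \<delta> by (intro mult_right_mono) auto
        finally show "xs \<in> affordable \<Gamma> n"
          using xs by (auto simp: affordable_def)
      qed
    qed (use \<rho> finite_affordable in auto)
    also have "\<dots> = real (card (affordable \<Gamma> n)) * \<rho> ^ n" by simp
    finally show ?thesis
      using 1(3)[of n] 2(3)[of n] c(2)[of n] split tails by linarith
  qed
  have "log 2 (q * \<rho>) < log 2 (growth w)"
    using \<delta> w by (simp add: q_def \<rho>_def log_mult log_powr)
  then have q\<rho>: "q * \<rho> < growth w"
    using \<rho> q gpos by (subst (asm) log_less_cancel_iff) auto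
  have \<rho>1: "\<rho> < growth w"
    using q \<rho> q\<rho> by (smt (verit) mult_le_cancel_right1)
  \<comment> \<open>The first term stands for the \<open>2 powr (n * R)\<close> messages, the second
    for the additional one due to rounding up, the last two for the tails; all are negligible
    against \<open>growth w ^ n\<close>.\<close>
  have "(\<lambda>n. (q * \<rho> / growth w) ^ n + (\<rho> / growth w) ^ n + C1 * (r1 / growth w) ^ n
      + C2 * (r2 / growth w) ^ n) \<longlonglongrightarrow> 0 + 0 + C1 * 0 + C2 * 0"
    using 1(1,2) 2(1,2) q\<rho> \<rho>1 \<rho> q gpos
    by (intro tendsto_intros LIMSEQ_power_zero) auto
  then have "eventually (\<lambda>n. (q * \<rho> / growth w) ^ n + (\<rho> / growth w) ^ n + C1 * (r1 / growth w) ^ n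
      + C2 * (r2 / growth w) ^ n < c) sequentially"
    using c(1) by (intro order_tendstoD) auto
  then have "eventually (\<lambda>n. card (messages R n) \<le> card (affordable \<Gamma> n)) sequentially"
  proof eventually_elim
    case (elim n)
    have "((q * \<rho> / growth w) ^ n + (\<rho> / growth w) ^ n + C1 * (r1 / growth w) ^ n
      + C2 * (r2 / growth w) ^ n) * growth w ^ n \<le> c * growth w ^ n"
      using elim gpos by (intro mult_right_mono) auto
    then have "(q * \<rho>) ^ n + \<rho> ^ n + C1 * r1 ^ n + C2 * r2 ^ n \<le> c * growth w ^ n"
      using gpos by (simp add: power_divide distrib_right)
    with main[of n] have "(q ^ n + 1) * \<rho> ^ n \<le> real (card (affordable \<Gamma> n)) * \<rho> ^ n"
      by (simp add: power_mult_distrib distrib_right)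
    then have "q ^ n + 1 \<le> real (card (affordable \<Gamma> n))"
      using \<rho> by simp
    moreover have "2 powr (real n * R) = q ^ n"
      by (simp add: q_def powr_power mult_ac)
    ultimately show ?case
      unfolding card_messages by linarith
  qed
  then show ?thesis
    using achievable_cognitiveI \<open>\<Gamma> \<ge> 0\<close> by blast
qed

text \<open>The rate 0 is achievable with a single message, so the supremum is over a nonempty set.
  Achievability strictly below \<open>C\<close> suffices: an upper bound \<open>u < C\<close> is
  refuted by the midpoint of \<open>u\<close> and \<open>C\<close>.\<close>

lemma capacity_cognitive_eqI:
  assumes "\<Gamma> \<ge> 0"
    and le: "\<And>R. achievable_cognitive noiseless_ternary \<Gamma> R \<Longrightarrow> R \<le> C"
    and ach: "\<And>R. 0 \<le> R \<Longrightarrow> R < C \<Longrightarrow> achievable_cognitive noiseless_ternary \<Gamma> R"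
  shows "capacity_cognitive noiseless_ternary \<Gamma> = C"
proof -
  have "card (messages 0 n) \<le> card (affordable \<Gamma> n)" for n
    using replicate_0_affordable[OF assms(1), of n] finite_affordable[of \<Gamma> n]
    by (auto simp: card_messages Suc_le_eq card_gt_0_iff)
  then have 0: "achievable_cognitive noiseless_ternary \<Gamma> 0"
    using achievable_cognitiveI[OF assms(1)] by simp
  then have "C \<ge> 0" using le by blast
  show ?thesis unfolding capacity_cognitive_def
  proof (rule cSup_eq_non_empty)
    fix u assume u: "\<And>x. x \<in> {R. 0 \<le> R \<and> achievable_cognitive noiseless_ternary \<Gamma> R} \<Longrightarrow> x \<le> u"
    have "u \<ge> 0" using u 0 by simp
    show "C \<le> u"
    proof (rule ccontr)
      assume "\<not> C \<le> u"
      then show False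
        using u[of "(u + C) / 2"] ach[of "(u + C) / 2"] \<open>u \<ge> 0\<close> \<open>C \<ge> 0\<close> by simp
    qed
  qed (use 0 le in auto)
qed

subsection \<open>The cubic equation\<close>

text \<open>The inverse of \<open>\<zeta> = sqrt (4 / w + 5)\<close>. It maps
  \<open>\<zeta> \<ge> 3\<close> decreasingly onto the weights \<open>0 < w \<le> 1\<close>, with
  \<open>\<zeta> = 3\<close> at \<open>w = 1\<close>.\<close>

definition tilt :: "real \<Rightarrow> real" where
  "tilt \<zeta> = 4 / (\<zeta> ^ 2 - 5)"

text \<open>The rational form that \<open>mean_rate\<close> takes in the variable
  \<open>\<zeta>\<close>; see \<open>mean_rate_tilt\<close>.\<close>

definition tilt_rate :: "real \<Rightarrow> real" where
  "tilt_rate \<zeta> = (\<zeta> ^ 2 + 2 * \<zeta> + 5) / (\<zeta> * (\<zeta> + 3) * (\<zeta> - 1))"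

lemma square_ge_9:
  assumes "(\<zeta>::real) \<ge> 3"
  shows "\<zeta> ^ 2 \<ge> 9"
  using power_mono[OF assms, of 2] by simp

lemma tilt_pos_le_1:
  assumes "\<zeta> \<ge> 3"
  shows "0 < tilt \<zeta>" "tilt \<zeta> \<le> 1"
  using square_ge_9[OF assms] by (auto simp: tilt_def)

lemma sqrt_tilt:
  assumes "\<zeta> \<ge> 3"
  shows "sqrt (4 * tilt \<zeta> + 5 * tilt \<zeta> ^ 2) = tilt \<zeta> * \<zeta>"
proof (rule real_sqrt_unique)
  have "\<zeta> ^ 2 - 5 > 0" using square_ge_9[OF assms] by simp
  then show "(tilt \<zeta> * \<zeta>) ^ 2 = 4 * tilt \<zeta> + 5 * tilt \<zeta> ^ 2"
    by (simp add: tilt_def power_mult_distrib power_divide divide_simps) algebra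
  show "tilt \<zeta> * \<zeta> \<ge> 0" using tilt_pos_le_1[OF assms] assms by simp
qed

lemma growth_tilt:
  assumes "\<zeta> \<ge> 3"
  shows "growth (tilt \<zeta>) = (\<zeta> ^ 2 + 2 * \<zeta> - 3) / (\<zeta> ^ 2 - 5)"
proof -
  define q where "q = \<zeta> ^ 2 - 5"
  have q: "q > 0" using square_ge_9[OF assms] by (simp add: q_def)
  have t: "tilt \<zeta> = 4 / q" by (simp add: tilt_def q_def)
  have "growth (tilt \<zeta>) = (q + 2 * \<zeta> + 2) / q"
    unfolding growth_def sqrt_tilt[OF assms] unfolding t using q by (simp add: field_simps)
  then show ?thesis by (simp add: q_def algebra_simps)
qed

lemma mean_rate_tilt:
  assumes "\<zeta> \<ge> 3"
  shows "mean_rate (tilt \<zeta>) = tilt_rate \<zeta>"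
proof -
  define q where "q = \<zeta> ^ 2 - 5"
  have q: "q > 0" using square_ge_9[OF assms] by (simp add: q_def)
  have t: "tilt \<zeta> = 4 / q" by (simp add: tilt_def q_def)
  have "tilt \<zeta> * ((1 + (2 + 5 * tilt \<zeta>) / (tilt \<zeta> * \<zeta>)) / 2) = (2 * \<zeta> + q + 10) / (\<zeta> * q)"
    using q assms unfolding t by (simp add: field_simps)
  also have "2 * \<zeta> + q + 10 = \<zeta> ^ 2 + 2 * \<zeta> + 5" by (simp add: q_def)
  finally have num: "tilt \<zeta> * ((1 + (2 + 5 * tilt \<zeta>) / (tilt \<zeta> * \<zeta>)) / 2) =
      (\<zeta> ^ 2 + 2 * \<zeta> + 5) / (\<zeta> * q)" .
  have "mean_rate (tilt \<zeta>) = ((\<zeta> ^ 2 + 2 * \<zeta> + 5) / (\<zeta> * q)) / ((\<zeta> ^ 2 + 2 * \<zeta> - 3) / q)"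
    unfolding mean_rate_def sqrt_tilt[OF assms] growth_tilt[OF assms] num q_def[symmetric] ..
  also have "\<dots> = (\<zeta> ^ 2 + 2 * \<zeta> + 5) / (\<zeta> * (\<zeta> ^ 2 + 2 * \<zeta> - 3))"
    using q by simp
  also have "\<zeta> ^ 2 + 2 * \<zeta> - 3 = (\<zeta> + 3) * (\<zeta> - 1)" by algebra
  finally show ?thesis by (simp add: tilt_rate_def mult.assoc)
qed

lemma tilt_rate_strict_antimono:
  assumes "1 < x" "x < y"
  shows "tilt_rate y < tilt_rate x"
proof -
  \<comment> \<open>The numerator exceeds \<open>(z + 3) * (z - 1)\<close> by 8, which writes the
    rate as a product of two positive decreasing factors.\<close>
  have eq: "tilt_rate z = (1 + 8 / ((z + 3) * (z - 1))) * (1 / z)" if "z > 1" for z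
  proof -
    define d where "d = (z + 3) * (z - 1)"
    have "d > 0" using that by (simp add: d_def)
    have "z ^ 2 + 2 * z + 5 = d + 8" unfolding d_def by algebra
    then have "tilt_rate z = (d + 8) / (z * d)"
      by (simp add: tilt_rate_def d_def mult.assoc)
    also have "\<dots> = (1 + 8 / d) * (1 / z)"
      using that \<open>d > 0\<close> by (simp add: field_simps)
    finally show ?thesis by (simp add: d_def)
  qed
  have "(x + 3) * (x - 1) < (y + 3) * (y - 1)"
    using assms by (intro mult_strict_mono) auto
  then have "8 / ((y + 3) * (y - 1)) < 8 / ((x + 3) * (x - 1))"
    using assms by (intro divide_strict_left_mono mult_pos_pos) auto
  moreover have "1 / y < 1 / x" using assms by (intro divide_strict_left_mono) auto
  moreover have "8 / ((y + 3) * (y - 1)) > 0" "1 / y > 0" using assms by simp_all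
  ultimately have "(1 + 8 / ((y + 3) * (y - 1))) * (1 / y) < (1 + 8 / ((x + 3) * (x - 1))) * (1 / x)"
    by (intro mult_strict_mono') linarith+
  then show ?thesis using eq[of x] eq[of y] assms by simp
qed

definition cubic :: "real \<Rightarrow> real \<Rightarrow> real" where
  "cubic \<Gamma> \<zeta> = \<Gamma> * \<zeta> ^ 3 + 2 * (\<Gamma> - 1) * \<zeta> ^ 2 - (3 * \<Gamma> + 4) * \<zeta> - 10"

lemma cubic_eq: "cubic \<Gamma> \<zeta> = \<Gamma> * (\<zeta> * (\<zeta> + 3) * (\<zeta> - 1)) - 2 * (\<zeta> ^ 2 + 2 * \<zeta> + 5)"
  unfolding cubic_def by algebra

text \<open>At a root, \<open>\<Gamma> * p\<close> is positive, so \<open>p\<close> is too and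
  \<open>\<Gamma>\<close> may be enlarged to 10/9. For that value 3 is a root, and the remaining
  quadratic factor is positive, which excludes every \<open>\<zeta> < 3\<close>, negative ones
  included.\<close>

lemma cubic_root_ge_3:
  assumes "0 < \<Gamma>" "\<Gamma> \<le> 10 / 9" "cubic \<Gamma> \<zeta> = 0"
  shows "\<zeta> \<ge> 3"
proof (rule ccontr)
  assume "\<not> \<zeta> \<ge> 3"
  define p where "p = \<zeta> * (\<zeta> + 3) * (\<zeta> - 1)"
  have sq: "\<zeta> ^ 2 + 2 * \<zeta> + 5 = (\<zeta> + 1) ^ 2 + 4"
    "\<zeta> ^ 2 + 16 / 5 * \<zeta> + 3 = (\<zeta> + 8 / 5) ^ 2 + 11 / 25"
    by (simp_all add: power2_eq_square algebra_simps)
  have pos: "\<zeta> ^ 2 + 2 * \<zeta> + 5 > 0" "\<zeta> ^ 2 + 16 / 5 * \<zeta> + 3 > 0"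
    unfolding sq by (simp_all add: add_nonneg_pos)
  have "\<Gamma> * p = 2 * (\<zeta> ^ 2 + 2 * \<zeta> + 5)" using assms by (simp add: cubic_eq p_def)
  moreover from this have "p > 0" using pos assms by (smt (verit) zero_less_mult_iff)
  then have "\<Gamma> * p \<le> 10 / 9 * p" using assms by (intro mult_right_mono) auto
  moreover have "10 / 9 * p - 2 * (\<zeta> ^ 2 + 2 * \<zeta> + 5) = 10 / 9 * ((\<zeta> - 3) * (\<zeta> ^ 2 + 16 / 5 * \<zeta> + 3))"
    by (simp add: p_def power2_eq_square field_simps)
  moreover have "(\<zeta> - 3) * (\<zeta> ^ 2 + 16 / 5 * \<zeta> + 3) < 0"
    using \<open>\<not> \<zeta> \<ge> 3\<close> pos by (intro mult_neg_pos) auto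
  ultimately show False by linarith
qed

lemma cubic_root_iff:
  assumes "\<zeta> \<ge> 3"
  shows "cubic \<Gamma> \<zeta> = 0 \<longleftrightarrow> tilt_rate \<zeta> = \<Gamma> / 2"
proof -
  have "\<zeta> * (\<zeta> + 3) * (\<zeta> - 1) > 0" using assms by (intro mult_pos_pos) auto
  then show ?thesis
    unfolding cubic_eq tilt_rate_def by (subst divide_eq_eq) auto
qed

lemma ex1_cubic_root:
  assumes "0 < \<Gamma>" "\<Gamma> \<le> 10 / 9"
  shows "\<exists>!\<zeta>. cubic \<Gamma> \<zeta> = 0"
proof -
  \<comment> \<open>With this right end \<open>\<Gamma> * b\<close> is the constant 10/3, so the
    cubic at \<open>b\<close> becomes a quadratic in \<open>b\<close> with root 3;
    \<open>b \<ge> 3\<close> is the condition \<open>\<Gamma> \<le> 10 / 9\<close>. At the left end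
    the cubic is \<open>36 * \<Gamma> - 40\<close>.\<close>
  define b where "b = 10 / (3 * \<Gamma>)"
  have b: "b \<ge> 3" using assms by (simp add: b_def field_simps)
  have "cubic \<Gamma> 3 \<le> 0" using assms by (simp add: cubic_def)
  moreover have "0 \<le> cubic \<Gamma> b"
  proof -
    have "\<Gamma> * (b * (b + 3) * (b - 1)) = 10 / 3 * ((b + 3) * (b - 1))"
      using assms by (simp add: b_def)
    moreover have "10 / 3 * ((b + 3) * (b - 1)) - 2 * (b ^ 2 + 2 * b + 5) = 4 / 3 * ((b - 3) * (b + 5))"
      by (simp add: power2_eq_square algebra_simps)
    moreover have "(b - 3) * (b + 5) \<ge> 0" using b by simp
    ultimately show ?thesis unfolding cubic_eq by linarith
  qed
  moreover have "continuous_on {3..b} (cubic \<Gamma>)"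
    unfolding cubic_def by (intro continuous_intros)
  ultimately obtain z where "cubic \<Gamma> z = 0"
    using IVT'[of "cubic \<Gamma>" 3 0 b] b by auto
  moreover have "x = y" if "cubic \<Gamma> x = 0" "cubic \<Gamma> y = 0" for x y
  proof -
    have ge: "x \<ge> 3" "y \<ge> 3"
      using that cubic_root_ge_3[OF assms] by auto
    then have "tilt_rate x = tilt_rate y"
      using that cubic_root_iff[of x \<Gamma>] cubic_root_iff[of y \<Gamma>] by simp
    with ge have "\<not> x < y" "\<not> y < x"
      using tilt_rate_strict_antimono[of x y] tilt_rate_strict_antimono[of y x] by auto
    then show ?thesis by simp
  qed
  ultimately show ?thesis by blast
qed

subsection \<open>The capacity\<close>

text \<open>At \<open>w = tilt \<zeta>\<close> the cubic equation says
  \<open>mean_rate w = \<Gamma> / 2\<close>, and there the upper bound and the limit of the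
  achievable rates coincide.\<close>

lemma capacity_cognitive_below_threshold:
  assumes \<Gamma>: "0 < \<Gamma>" "\<Gamma> \<le> 10 / 9" and root: "cubic \<Gamma> \<zeta> = 0"
  shows "capacity_cognitive noiseless_ternary \<Gamma> =
    log 2 (\<zeta> ^ 2 + 2 * \<zeta> - 3) + (\<Gamma> - 2) / 2 * log 2 (\<zeta> ^ 2 - 5) - \<Gamma>"
proof -
  have \<zeta>: "\<zeta> \<ge> 3" and rate: "tilt_rate \<zeta> = \<Gamma> / 2"
    using cubic_root_ge_3[OF assms] cubic_root_iff root by auto
  define G where "G = (\<lambda>z. log 2 (growth (tilt z)) - tilt_rate z * log 2 (tilt z))"
  \<comment> \<open>The explicit form of \<open>G\<close> for \<open>z \<ge> 3\<close>, whose
    continuity at \<open>\<zeta>\<close> follows from that of its constituents.\<close>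
  define F where "F = (\<lambda>z. log 2 ((z ^ 2 + 2 * z - 3) / (z ^ 2 - 5)) -
    (z ^ 2 + 2 * z + 5) / (z * (z + 3) * (z - 1)) * log 2 (4 / (z ^ 2 - 5)))"
  have FG: "F z = G z" if "z \<ge> 3" for z
    using growth_tilt[OF that] by (simp add: F_def G_def tilt_rate_def tilt_def)
  have sq: "\<zeta> ^ 2 \<ge> 9" using square_ge_9[OF \<zeta>] .
  have "capacity_cognitive noiseless_ternary \<Gamma> = G \<zeta>"
  proof (rule capacity_cognitive_eqI)
    show "R \<le> G \<zeta>" if "achievable_cognitive noiseless_ternary \<Gamma> R" for R
      using achievable_cognitive_le[OF that tilt_pos_le_1[OF \<zeta>]] by (simp add: G_def rate)
    \<comment> \<open>Moving slightly beyond \<open>\<zeta>\<close> makes the charge rate strictly smaller than \<open>\<Gamma>/2\<close>.\<close>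
    fix R assume R: "0 \<le> R" "R < G \<zeta>"
    have "(F \<longlongrightarrow> F \<zeta>) (at_right \<zeta>)"
      unfolding F_def using \<zeta> sq by (intro tendsto_intros) auto
    then have "eventually (\<lambda>z. R < F z) (at_right \<zeta>)"
      using R FG[OF \<zeta>] by (intro order_tendstoD) auto
    moreover have "eventually (\<lambda>z. z > \<zeta>) (at_right \<zeta>)"
      by (rule eventually_at_right_less)
    ultimately have "eventually (\<lambda>z. R < F z \<and> z > \<zeta>) (at_right \<zeta>)"
      by (rule eventually_conj)
    then obtain z where z: "R < F z" "z > \<zeta>"
      using eventually_happens'[OF trivial_limit_at_right_real] by blast
    have "z \<ge> 3" "tilt_rate z < \<Gamma> / 2"
      using z \<zeta> rate tilt_rate_strict_antimono[of \<zeta> z] by auto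
    then show "achievable_cognitive noiseless_ternary \<Gamma> R"
      using achievable_cognitive_below_rate[OF tilt_pos_le_1, of z \<Gamma> R] R z FG[of z]
      by (simp add: mean_rate_tilt G_def)
  qed (use \<Gamma> in simp)
  also have "G \<zeta> = log 2 (\<zeta> ^ 2 + 2 * \<zeta> - 3) - log 2 (\<zeta> ^ 2 - 5)
      - \<Gamma> / 2 * (log 2 4 - log 2 (\<zeta> ^ 2 - 5))"
    unfolding G_def growth_tilt[OF \<zeta>] rate unfolding tilt_def
    using \<zeta> sq by (simp add: log_divide)
  also have "log 2 (4::real) = 2"
    using log_pow_cancel[of 2 2] by simp
  finally show ?thesis by (simp add: field_simps)
qed

text \<open>The weight 1 counts all ternary words. Typical ones need about 5/9 lazy charges per
  symbol, at cost 10/9, so the constraint does not bind.\<close>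

lemma capacity_cognitive_above_threshold:
  assumes "\<Gamma> > 10 / 9"
  shows "capacity_cognitive noiseless_ternary \<Gamma> = log 2 3"
proof (rule capacity_cognitive_eqI)
  have 1: "tilt 3 = 1" "growth 1 = 3" "mean_rate 1 = 5 / 9"
    using growth_tilt[of 3] mean_rate_tilt[of 3] by (simp_all add: tilt_def tilt_rate_def)
  show "R \<le> log 2 3" if "achievable_cognitive noiseless_ternary \<Gamma> R" for R
    using achievable_cognitive_le[OF that, of 1] 1 by simp
  show "achievable_cognitive noiseless_ternary \<Gamma> R" if "0 \<le> R" "R < log 2 3" for R
    using achievable_cognitive_below_rate[of 1 \<Gamma> R] 1 that assms by simp
qed (use assms in simp)

text \<open>For \<open>\<Gamma> = 0\<close> every \<open>w\<close> in (0,1] gives the bound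
  \<open>log 2 (growth w)\<close>, which tends to 0 as \<open>w\<close> tends to 0.\<close>

lemma capacity_cognitive_0: "capacity_cognitive noiseless_ternary 0 = 0"
proof (rule capacity_cognitive_eqI)
  show "R \<le> 0" if "achievable_cognitive noiseless_ternary 0 R" for R
  proof (rule tendsto_lowerbound)
    have "((\<lambda>w. log 2 (growth w)) \<longlongrightarrow> log 2 (growth 0)) (at_right 0)"
      unfolding growth_def by (intro tendsto_intros) auto
    then show "((\<lambda>w. log 2 (growth w)) \<longlongrightarrow> 0) (at_right 0)"
      by (simp add: growth_def)
    have "eventually (\<lambda>w. w \<in> {0<..<1}) (at_right (0::real))"
      by (intro eventually_at_right_real) auto
    then show "eventually (\<lambda>w. R \<le> log 2 (growth w)) (at_right 0)"
      by eventually_elim (use achievable_cognitive_le[OF that] in fastforce)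
  qed simp
qed auto

theorem proposition4:
  "(\<forall>\<Gamma>::real. 0 < \<Gamma> \<and> \<Gamma> \<le> 10 / 9 \<longrightarrow>
      (\<exists>!\<zeta>::real. \<Gamma> * \<zeta> ^ 3 + 2 * (\<Gamma> - 1) * \<zeta> ^ 2 - (3 * \<Gamma> + 4) * \<zeta> - 10 = 0) \<and>
      (\<forall>\<zeta>::real. \<Gamma> * \<zeta> ^ 3 + 2 * (\<Gamma> - 1) * \<zeta> ^ 2 - (3 * \<Gamma> + 4) * \<zeta> - 10 = 0 \<longrightarrow>
         capacity_cognitive noiseless_ternary \<Gamma>
           = log 2 (\<zeta> ^ 2 + 2 * \<zeta> - 3) + (\<Gamma> - 2) / 2 * log 2 (\<zeta> ^ 2 - 5) - \<Gamma>)) \<and>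
   capacity_cognitive noiseless_ternary 0 = 0 \<and>
   (\<forall>\<Gamma>::real. 10 / 9 < \<Gamma> \<longrightarrow> capacity_cognitive noiseless_ternary \<Gamma> = log 2 3)"
proof (intro conjI allI impI; (elim conjE)?)
  fix \<Gamma> :: real assume \<Gamma>: "0 < \<Gamma>" "\<Gamma> \<le> 10 / 9"
  show "\<exists>!\<zeta>. \<Gamma> * \<zeta> ^ 3 + 2 * (\<Gamma> - 1) * \<zeta> ^ 2 - (3 * \<Gamma> + 4) * \<zeta> - 10 = 0"
    using ex1_cubic_root[OF \<Gamma>] unfolding cubic_def .
  fix \<zeta> :: real assume "\<Gamma> * \<zeta> ^ 3 + 2 * (\<Gamma> - 1) * \<zeta> ^ 2 - (3 * \<Gamma> + 4) * \<zeta> - 10 = 0"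
  then show "capacity_cognitive noiseless_ternary \<Gamma>
      = log 2 (\<zeta> ^ 2 + 2 * \<zeta> - 3) + (\<Gamma> - 2) / 2 * log 2 (\<zeta> ^ 2 - 5) - \<Gamma>"
    using capacity_cognitive_below_threshold[OF \<Gamma>] unfolding cubic_def by simp
next
  show "capacity_cognitive noiseless_ternary 0 = 0"
    by (rule capacity_cognitive_0)
  show "capacity_cognitive noiseless_ternary \<Gamma> = log 2 3" if "10 / 9 < \<Gamma>" for \<Gamma>
    using that by (rule capacity_cognitive_above_threshold)
qed

end
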